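(* Let $n\ge p\ge 1$ be integers, let $m_1,\dots,m_n$ be positive integers, let $y_i\in\{0,1,\dots,m_i\}$ for $i=1,\dots,n$, let $x_1,\dots,x_n\in\mathbb{R}^p$, and let $X=(x_1,\dots,x_n)^{\top}\in\mathbb{R}^{n\times p}$ be the matrix with rows $x_i^{\top}$. Consider the binomial regression models specified by the probit and the complementary log-log link functions, with, writing $z=x_i^{\top}\beta$, (i) probit regression: $\pi_i(\beta)=\Phi(z)$ and $w_i(\beta)=\dfrac{\{\phi(z)\}^2}{\Phi(z)\{1-\Phi(z)\}}$; (ii) complementary log-log regression: $w_i(\beta)=\dfrac{\exp(-2z)}{\exp(\exp(-z))-1}$, with success probability $\pi_i(\beta)=1-\exp(-\exp(-z))$. In each case define the Jeffreys-prior penalized log-likelihood $$l^*(\beta)=\sum_{i=1}^n\left[y_i\log\pi_i(\beta)+(m_i-y_i)\log\{1-\pi_i(\beta)\}\right]+\frac12\log|X^{\top}MW(\beta)X|,\qquad\beta\in\mathbb{R}^p,$$ where $M=\operatorname{diag}(m_1,\dots,m_n)$ and $W(\beta)=\operatorname{diag}\{w_1(\beta),\dots,w_n(\beta)\}$. In each of the cases (i) and (ii), if $X$ is of full column rank, then there exists a maximizer $\hat\beta\in\mathbb{R}^p$ of $l^*$, that is, $l^*(\hat\beta)=\sup_{\beta\in\mathbb{R}^p}l^*(\beta)$, and the set of maximizers $\operatorname{argmax}_{\beta\in\mathbb{R}^p}l^*(\beta)$ is bounded.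
   Context: $|A|$ denotes the determinant of a square matrix $A$. $\phi$ and $\Phi$ are the probability density function and the cumulative distribution function of the standard normal distribution, respectively. The $y_i$ are realizations of independent $\operatorname{Bin}(m_i,\pi_i(\beta))$ variables, and the first sum in $l^*$ is the log-likelihood up to an additive constant not depending on $\beta$. In both cases $w_i(\beta)=(d\pi_i/dz)^2/\{\pi_i(1-\pi_i)\}$, so that $X^{\top}MW(\beta)X$ is the Fisher information matrix. In case (ii) the link is $\log\{-\log(1-\pi_i)\}=-z$, i.e. the complementary log-log link with the sign of the linear predictor reversed. Since the $y_i$ are arbitrary, exchanging successes and failures ($y_i\mapsto m_i-y_i$) turns case (ii) into the model $\pi_i(\beta)=\exp(-\exp(-z))$ with the same $w_i$. *)

theory Defs
  imports "HOL-Probability.Probability"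
begin

definition std_normal_cdf :: "real \<Rightarrow> real"
  where "std_normal_cdf = cdf std_normal_distribution"

definition diag_matrix :: "('n \<Rightarrow> real) \<Rightarrow> real ^ 'n ^ 'n::finite"
  where "diag_matrix d = (\<chi> i j. if i = j then d i else 0)"

text \<open>
  Inverse link \<open>\<pi>\<close> and working weight \<open>w\<close> of each model, as functions of the linear
  predictor \<open>z\<close>.
\<close>

definition probit_prob :: "real \<Rightarrow> real"
  where "probit_prob z = std_normal_cdf z"

definition probit_weight :: "real \<Rightarrow> real"
  where "probit_weight z =
    (std_normal_density z)\<^sup>2 / (std_normal_cdf z * (1 - std_normal_cdf z))"

text \<open>
  The complementary log-log link is taken with the sign of the linear predictor reversed,
  \<open>ln (- ln (1 - \<pi>)) = - z\<close>.
\<close>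

definition cloglog_prob :: "real \<Rightarrow> real"
  where "cloglog_prob z = 1 - exp (- exp (- z))"

definition cloglog_weight :: "real \<Rightarrow> real"
  where "cloglog_weight z = exp (- 2 * z) / (exp (exp (- z)) - 1)"

text \<open>
  Observations are indexed by \<open>'n\<close> and coefficients by \<open>'p\<close>; row \<open>i\<close> of the design matrix
  \<open>X\<close> is the covariate vector \<open>x\<^sub>i\<close>, so that \<open>row i X \<bullet> \<beta>\<close> is the linear predictor.
\<close>

definition fisher_information ::
  "(real \<Rightarrow> real) \<Rightarrow> ('n \<Rightarrow> nat) \<Rightarrow> real ^ 'p ^ 'n \<Rightarrow> real ^ 'p \<Rightarrow> real ^ 'p ^ 'p"
  where "fisher_information w m X \<beta> =
    transpose X ** diag_matrix (\<lambda>i. real (m i)) ** diag_matrix (\<lambda>i. w (row i X \<bullet> \<beta>)) ** X"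

definition jeffreys_penalized_loglik ::
  "(real \<Rightarrow> real) \<Rightarrow> (real \<Rightarrow> real) \<Rightarrow> ('n \<Rightarrow> nat) \<Rightarrow> ('n \<Rightarrow> nat) \<Rightarrow> real ^ 'p ^ 'n \<Rightarrow> real ^ 'p \<Rightarrow> real"
  where "jeffreys_penalized_loglik \<pi> w m y X \<beta> =
    (\<Sum>i\<in>UNIV. real (y i) * ln (\<pi> (row i X \<bullet> \<beta>))
               + (real (m i) - real (y i)) * ln (1 - \<pi> (row i X \<bullet> \<beta>)))
    + 1 / 2 * ln (det (fisher_information w m X \<beta>))"

text \<open>
  Boundedness above is required explicitly because the real-valued \<open>SUP\<close> of a set that is
  not bounded above is unspecified.
\<close>

definition is_maximizer :: "('a \<Rightarrow> real) \<Rightarrow> 'a \<Rightarrow> bool"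
  where "is_maximizer f b \<longleftrightarrow> bdd_above (range f) \<and> f b = (SUP x. f x)"

end

theory Submission
  imports Defs
begin

text \<open>
  The log-likelihood part is nonpositive, so it suffices that the determinant of the information
  matrix \<open>A(\<beta>)\<close> tends to \<open>0\<close> as \<open>\<beta>\<close> tends to infinity. Both weight functions decay exponentially,
  so \<open>w(z)\<close> and \<open>z w(z)\<close> are bounded, and hence so are the entries of \<open>A(\<beta>)\<close> and of
  \<open>A(\<beta>) \<beta> = (\<Sum>i. m\<^sub>i w(z\<^sub>i) z\<^sub>i x\<^sub>i)\<close>, where \<open>z\<^sub>i\<close> is the linear predictor. By Cramer's rule
  \<open>\<beta>\<^sub>k det A(\<beta>)\<close> is the determinant of \<open>A(\<beta>)\<close> with column \<open>k\<close> replaced by \<open>A(\<beta>) \<beta>\<close>.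
  Therefore \<open>\<parallel>\<beta>\<parallel> det A(\<beta>)\<close> is bounded.
\<close>

section \<open>Determinants and maximizers\<close>

text \<open>In the Leibniz expansion there is one summand per permutation, and signs disappear in
  absolute value, so each summand costs at most \<open>D ^ CARD('n)\<close>.\<close>

lemma abs_det_le:
  fixes A :: "real ^ 'n ^ 'n"
  assumes "\<And>i j. \<bar>A $ i $ j\<bar> \<le> D"
  shows "\<bar>det A\<bar> \<le> fact CARD('n) * D ^ CARD('n)"
proof -
  have "\<bar>det A\<bar> \<le> (\<Sum>p | p permutes (UNIV :: 'n set). D ^ CARD('n))"
    unfolding det_def
  proof (rule sum_abs[THEN order_trans], rule sum_mono)
    fix p :: "'n \<Rightarrow> 'n"
    have "(\<Prod>i\<in>UNIV. \<bar>A $ i $ p i\<bar>) \<le> (\<Prod>i\<in>(UNIV :: 'n set). D)"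
      using assms by (intro prod_mono) auto
    then show "\<bar>of_int (sign p) * (\<Prod>i\<in>UNIV. A $ i $ p i)\<bar> \<le> D ^ CARD('n)"
      by (simp add: abs_mult sign_def abs_prod)
  qed
  also have "\<dots> = fact CARD('n) * D ^ CARD('n)"
    using card_permutations[of "UNIV :: 'n set"] by simp
  finally show ?thesis .
qed

lemma norm_mult_abs_det_le:
  fixes A :: "real ^ 'n ^ 'n" and D :: real
  assumes "\<And>i j. \<bar>A $ i $ j\<bar> \<le> D" and "\<And>i. \<bar>(A *v x) $ i\<bar> \<le> D"
  shows "norm x * \<bar>det A\<bar> \<le> real CARD('n) * (fact CARD('n) * D ^ CARD('n))"
proof -
  have "norm x * \<bar>det A\<bar> \<le> (\<Sum>k\<in>UNIV. \<bar>x $ k\<bar>) * \<bar>det A\<bar>"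
    by (intro mult_right_mono norm_le_l1_cart) auto
  also have "\<dots> = (\<Sum>k\<in>UNIV. \<bar>x $ k * det A\<bar>)"
    by (simp add: sum_distrib_right abs_mult)
  also have "\<dots> \<le> (\<Sum>k\<in>(UNIV :: 'n set). fact CARD('n) * D ^ CARD('n))"
  proof (rule sum_mono)
    fix k :: 'n
    show "\<bar>x $ k * det A\<bar> \<le> fact CARD('n) * D ^ CARD('n)"
      \<comment> \<open>The matrix on the right has column \<open>k\<close> replaced by
        \<open>A *v x\<close>, so the two assumptions together bound all its entries by
        \<open>D\<close>.\<close>
      unfolding cramer_lemma[symmetric] using assms by (intro abs_det_le) auto
  qed
  finally show ?thesis
    by simp
qed

text \<open>A maximum over a compact ball containing 0 is global, since values outside lie below
  \<open>f 0\<close>. Strictness of that comparison confines every maximizer to the ball.\<close>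

lemma maximizers_exist_bounded:
  fixes f :: "'a::euclidean_space \<Rightarrow> real"
  assumes cont: "continuous_on UNIV f"
    and small: "\<And>x. R < norm x \<Longrightarrow> f x < f 0"
  shows "(\<exists>b. is_maximizer f b) \<and> bounded {b. is_maximizer f b}"
proof
  \<comment> \<open>The absolute value keeps the ball nonempty, with 0 in it, even if
    \<open>R\<close> is negative.\<close>
  have "continuous_on (cball 0 \<bar>R\<bar>) f"
    using cont continuous_on_subset by blast
  then obtain b where b: "\<And>x. x \<in> cball 0 \<bar>R\<bar> \<Longrightarrow> f x \<le> f b"
    using continuous_attains_sup[of "cball 0 \<bar>R\<bar>" f] by (metis compact_cball cball_eq_empty abs_ge_zero not_less)
  have "f x \<le> f b" for x
  proof (cases "norm x \<le> \<bar>R\<bar>")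
    case False
    then have "f x < f 0"
      by (intro small) auto
    then show ?thesis
      using b[of 0] by simp
  qed (simp add: b)
  then show "\<exists>b. is_maximizer f b"
    unfolding is_maximizer_def
    by (intro exI[of _ b] conjI bdd_aboveI2 antisym cSUP_upper cSUP_least) (auto intro!: bdd_aboveI2)
  have "norm b \<le> R" if "is_maximizer f b" for b
  proof -
    have "f 0 \<le> f b"
      using that unfolding is_maximizer_def by (metis UNIV_I cSUP_upper)
    then show ?thesis
      using small[of b] by fastforce
  qed
  then show "bounded {b. is_maximizer f b}"
    by (auto intro!: boundedI)
qed

section \<open>The penalized likelihood\<close>

lemma fisher_information_nth:
  "fisher_information w m X \<beta> $ j $ k =
    (\<Sum>i\<in>UNIV. real (m i) * w (row i X \<bullet> \<beta>) * X $ i $ j * X $ i $ k)"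
  by (simp add: fisher_information_def diag_matrix_def matrix_matrix_mult_def transpose_def
      if_distrib if_distribR sum.delta sum.delta' mult_ac cong: if_cong)

lemma row_inner_eq: "row i X \<bullet> v = (\<Sum>k\<in>UNIV. X $ i $ k * v $ k)"
  by (simp add: row_def inner_vec_def)

text \<open>For \<open>v = \<beta>\<close> each weight meets its own linear predictor in the product
  \<open>w z * z\<close>, which stays bounded. For general \<open>v\<close> this form leads to the
  quadratic form of the matrix.\<close>

lemma fisher_information_mult_nth:
  "(fisher_information w m X \<beta> *v v) $ j =
    (\<Sum>i\<in>UNIV. real (m i) * w (row i X \<bullet> \<beta>) * (row i X \<bullet> v) * X $ i $ j)"
proof -
  have "(fisher_information w m X \<beta> *v v) $ j =
      (\<Sum>k\<in>UNIV. \<Sum>i\<in>UNIV. real (m i) * w (row i X \<bullet> \<beta>) * X $ i $ j * X $ i $ k * v $ k)"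
    by (simp add: matrix_vector_mult_def fisher_information_nth sum_distrib_right)
  also have "\<dots> = (\<Sum>i\<in>UNIV. real (m i) * w (row i X \<bullet> \<beta>) * (row i X \<bullet> v) * X $ i $ j)"
    unfolding row_inner_eq[of _ _ v]
    by (subst sum.swap) (simp add: sum_distrib_left sum_distrib_right mult_ac)
  finally show ?thesis .
qed

text \<open>The quadratic form at \<open>v\<close> is a sum of squares of
  \<open>row i X \<bullet> v\<close> with positive coefficients. A kernel vector therefore satisfies
  \<open>X *v v = 0\<close>, and full column rank makes it zero.\<close>

lemma det_fisher_information_nonzero:
  fixes X :: "real ^ 'p ^ 'n"
  assumes m: "\<And>i. 0 < m i" and w: "\<And>z. 0 < w z" and rank: "rank X = CARD('p)"
  shows "det (fisher_information w m X \<beta>) \<noteq> 0"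
proof -
  let ?A = "fisher_information w m X \<beta>"
  have "v = 0" if "?A *v v = 0" for v
  proof -
    have "0 = (\<Sum>j\<in>UNIV. (?A *v v) $ j * v $ j)"
      using that by simp
    also have "\<dots> = (\<Sum>j\<in>UNIV. \<Sum>i\<in>UNIV.
        real (m i) * w (row i X \<bullet> \<beta>) * (row i X \<bullet> v) * (X $ i $ j * v $ j))"
      unfolding fisher_information_mult_nth by (simp add: sum_distrib_left sum_distrib_right mult_ac)
    also have "\<dots> = (\<Sum>i\<in>UNIV. real (m i) * w (row i X \<bullet> \<beta>) * (row i X \<bullet> v)\<^sup>2)"
      by (subst sum.swap)
        (simp only: sum_distrib_left[symmetric] row_inner_eq[symmetric] power2_eq_square mult.assoc)
    finally have "(\<Sum>i\<in>UNIV. real (m i) * w (row i X \<bullet> \<beta>) * (row i X \<bullet> v)\<^sup>2) = 0"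
      by simp
    then have "\<forall>i\<in>UNIV. real (m i) * w (row i X \<bullet> \<beta>) * (row i X \<bullet> v)\<^sup>2 = 0"
      by (subst (asm) sum_nonneg_eq_0_iff) (auto simp: w less_imp_le)
    then have "row i X \<bullet> v = 0" for i
      using m[of i] w[of "row i X \<bullet> \<beta>"] by (metis UNIV_I less_irrefl mult_eq_0_iff of_nat_0_less_iff zero_eq_power2)
    then have "X *v v = 0"
      by (simp add: vec_eq_iff matrix_vector_mult_def row_inner_eq)
    then show "v = 0"
      using rank by (metis full_rank_injective injD matrix_vector_mult_0_right)
  qed
  then have "invertible ?A"
    by (simp add: invertible_left_inverse matrix_left_invertible_ker)
  then show ?thesis
    by (simp add: invertible_det_nz)
qed

lemma norm_mult_abs_det_fisher_information_le:
  fixes X :: "real ^ 'p ^ 'n"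
  assumes w: "\<And>z. \<bar>w z\<bar> * (1 + \<bar>z\<bar>) \<le> C"
  obtains E where "0 \<le> E" and "\<And>\<beta>. norm \<beta> * \<bar>det (fisher_information w m X \<beta>)\<bar> \<le> E"
proof -
  \<comment> \<open>\<open>N\<close> bounds the entries of \<open>X\<close> and is at least 1, so
    the same \<open>D\<close> covers summands with two entries of \<open>X\<close> and those with
    only one.\<close>
  define N where "N = 1 + norm X"
  define D where "D = (\<Sum>i\<in>UNIV. real (m i) * C * N * N)"
  have N: "1 \<le> N" and X: "\<bar>X $ i $ j\<bar> \<le> N" for i j
    using component_le_norm_cart[of "X $ i" j] Finite_Cartesian_Product.norm_nth_le[of X i] by (auto simp: N_def)
  have wC: "\<bar>w z\<bar> \<le> C" and zwC: "\<bar>w z\<bar> * \<bar>z\<bar> \<le> C" and C: "0 \<le> C" for z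
    using w[of z] mult_nonneg_nonneg[OF abs_ge_zero abs_ge_zero, of "w z" z] abs_ge_zero[of "w z"]
    unfolding distrib_left by linarith+
  have entry: "\<bar>fisher_information w m X \<beta> $ j $ k\<bar> \<le> D" for \<beta> j k
    unfolding fisher_information_nth D_def
  proof (rule sum_abs[THEN order_trans], rule sum_mono)
    fix i
    show "\<bar>real (m i) * w (row i X \<bullet> \<beta>) * X $ i $ j * X $ i $ k\<bar> \<le> real (m i) * C * N * N"
      unfolding abs_mult using N C by (intro mult_mono X wC mult_nonneg_nonneg) auto
  qed
  have vec: "\<bar>(fisher_information w m X \<beta> *v \<beta>) $ j\<bar> \<le> D" for \<beta> j
    unfolding fisher_information_mult_nth D_def
  proof (rule sum_abs[THEN order_trans], rule sum_mono)
    fix i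
    let ?z = "row i X \<bullet> \<beta>"
    have "\<bar>real (m i) * w ?z * ?z * X $ i $ j\<bar> = real (m i) * (\<bar>w ?z\<bar> * \<bar>?z\<bar>) * 1 * \<bar>X $ i $ j\<bar>"
      by (simp add: abs_mult)
    also have "\<dots> \<le> real (m i) * C * N * N"
      using N C by (intro mult_mono X zwC mult_nonneg_nonneg) auto
    finally show "\<bar>real (m i) * w ?z * ?z * X $ i $ j\<bar> \<le> real (m i) * C * N * N" .
  qed
  show ?thesis
  proof (rule that)
    show "norm \<beta> * \<bar>det (fisher_information w m X \<beta>)\<bar> \<le> real CARD('p) * (fact CARD('p) * D ^ CARD('p))" for \<beta>
      by (rule norm_mult_abs_det_le[OF entry vec])
    show "0 \<le> real CARD('p) * (fact CARD('p) * D ^ CARD('p))"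
      using N C by (auto simp: D_def intro!: mult_nonneg_nonneg sum_nonneg zero_le_power)
  qed
qed

lemma jeffreys_maximizers_exist_bounded:
  fixes X :: "real ^ 'p ^ 'n"
  assumes m: "\<And>i. 0 < m i" and y: "\<And>i. y i \<le> m i" and rank: "rank X = CARD('p)"
    and \<pi>: "\<And>z. 0 < \<pi> z" "\<And>z. \<pi> z < 1"
    and cont_\<pi>: "continuous_on UNIV \<pi>" and cont_w: "continuous_on UNIV w"
    and w_pos: "\<And>z. 0 < w z" and w_le: "\<And>z. w z \<le> C * exp (- \<bar>z\<bar>)"
  shows "(\<exists>b. is_maximizer (jeffreys_penalized_loglik \<pi> w m y X) b) \<and>
    bounded {b. is_maximizer (jeffreys_penalized_loglik \<pi> w m y X) b}"
proof -
  let ?l = "jeffreys_penalized_loglik \<pi> w m y X"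
  let ?d = "\<lambda>\<beta>. det (fisher_information w m X \<beta>)"
  have d: "?d \<beta> \<noteq> 0" for \<beta>
    using m w_pos rank by (rule det_fisher_information_nonzero)
  have "0 \<le> C"
    using w_pos[of 0] w_le[of 0] by simp
  have "\<bar>w z\<bar> * (1 + \<bar>z\<bar>) \<le> C" for z
  proof -
    \<comment> \<open>The linear factor is absorbed by the exponential decay through
      \<open>1 + \<bar>z\<bar> \<le> exp \<bar>z\<bar>\<close>.\<close>
    have "\<bar>w z\<bar> * (1 + \<bar>z\<bar>) \<le> C * exp (- \<bar>z\<bar>) * exp \<bar>z\<bar>"
      using w_pos[of z] w_le[of z] exp_ge_add_one_self[of "\<bar>z\<bar>"] \<open>0 \<le> C\<close> by (intro mult_mono) auto
    then show ?thesis
      by (simp add: mult.assoc flip: exp_add)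
  qed
  then obtain E where "0 \<le> E" and E: "\<And>\<beta>. norm \<beta> * \<bar>?d \<beta>\<bar> \<le> E"
    by (rule norm_mult_abs_det_fisher_information_le) blast
  have l_le: "?l \<beta> \<le> 1 / 2 * ln \<bar>?d \<beta>\<bar>" for \<beta>
  proof -
    have "(\<Sum>i\<in>UNIV. real (y i) * ln (\<pi> (row i X \<bullet> \<beta>))
        + (real (m i) - real (y i)) * ln (1 - \<pi> (row i X \<bullet> \<beta>))) \<le> 0"
    proof (rule sum_nonpos)
      fix i
      show "real (y i) * ln (\<pi> (row i X \<bullet> \<beta>))
        + (real (m i) - real (y i)) * ln (1 - \<pi> (row i X \<bullet> \<beta>)) \<le> 0"
        using \<pi>[of "row i X \<bullet> \<beta>"] y[of i] by (intro add_nonpos_nonpos mult_nonneg_nonpos) auto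
    qed
    moreover \<comment> \<open>HOL's \<open>ln\<close> on the reals satisfies \<open>ln (- x) = ln x\<close>, so the sign of \<open>det\<close> is irrelevant.\<close>
    have "ln (?d \<beta>) = ln \<bar>?d \<beta>\<bar>"
      by (simp add: abs_if ln_minus)
    ultimately show ?thesis
      by (simp add: jeffreys_penalized_loglik_def)
  qed
  \<comment> \<open>No logarithm meets 0: the probabilities lie strictly between 0 and 1, and the
    information matrix is nonsingular.\<close>
  have "continuous_on UNIV ?l"
    unfolding jeffreys_penalized_loglik_def
  proof (intro continuous_intros)
    show "continuous_on UNIV ?d"
      unfolding det_def fisher_information_nth
      by (intro continuous_intros continuous_on_compose2[OF cont_w]) auto
  qed (use \<pi> d in \<open>auto intro!: continuous_intros continuous_on_compose2[OF cont_\<pi>]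
      simp: less_imp_neq order_less_imp_not_eq2\<close>)
  \<comment> \<open>The radius is chosen so that \<open>E / norm \<beta>\<close>, which bounds the
    absolute determinant, falls below \<open>exp (2 * ?l 0)\<close>; half its logarithm is then
    below \<open>?l 0\<close>. Since \<open>0 \<le> E\<close>, such a \<open>\<beta>\<close> is
    nonzero and its norm can be cancelled.\<close>
  moreover have "?l \<beta> < ?l 0" if "E * exp (- 2 * ?l 0) < norm \<beta>" for \<beta>
  proof -
    have "0 < norm \<beta>"
      using that \<open>0 \<le> E\<close> by (smt (verit) exp_ge_zero mult_nonneg_nonneg)
    have "norm \<beta> * \<bar>?d \<beta>\<bar> \<le> E"
      by (rule E)
    also have "E < norm \<beta> * exp (2 * ?l 0)"
      using mult_strict_right_mono[OF that, of "exp (2 * ?l 0)"]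
      by (simp add: mult.assoc flip: exp_add)
    finally have "\<bar>?d \<beta>\<bar> < exp (2 * ?l 0)"
      using \<open>0 < norm \<beta>\<close> by simp
    then have "ln \<bar>?d \<beta>\<bar> < ln (exp (2 * ?l 0))"
      using d[of \<beta>] by (subst ln_less_cancel_iff) auto
    then show ?thesis
      using l_le[of \<beta>] by simp
  qed
  ultimately show ?thesis
    by (rule maximizers_exist_bounded)
qed

section \<open>The probit and complementary log-log models\<close>

text \<open>The difference is the integral of the density over an interval of length 1. The density
  decreases in the absolute value of its argument, so its value at \<open>r\<close> is a lower bound
  for the integrand.\<close>

lemma std_normal_density_le_cdf_diff:
  assumes "\<And>t. x \<le> t \<Longrightarrow> t \<le> x + 1 \<Longrightarrow> \<bar>t\<bar> \<le> r"
  shows "std_normal_density r \<le> std_normal_cdf (x + 1) - std_normal_cdf x"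
proof -
  interpret real_distribution std_normal_distribution
    by (rule real_dist_normal_dist)
  have "ennreal (std_normal_density r) = (\<integral>\<^sup>+t\<in>{x<..x+1}. ennreal (std_normal_density r) \<partial>lborel)"
    by (simp add: nn_integral_cmult_indicator)
  also have "\<dots> \<le> (\<integral>\<^sup>+t\<in>{x<..x+1}. ennreal (std_normal_density t) \<partial>lborel)"
  proof (intro nn_integral_mono)
    fix t
    have "std_normal_density r \<le> std_normal_density t" if "t \<in> {x<..x+1}"
      using assms[of t] that abs_le_square_iff[of t r] unfolding std_normal_density_def
      by (intro mult_left_mono) auto
    then show "ennreal (std_normal_density r) * indicator {x<..x+1} t
        \<le> ennreal (std_normal_density t) * indicator {x<..x+1} t"
      by (auto simp: indicator_def intro!: ennreal_leI)
  qed
  also have "\<dots> = emeasure std_normal_distribution {x<..x+1}"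
    by (simp add: emeasure_density)
  finally show ?thesis
    by (simp add: std_normal_cdf_def cdf_diff_eq emeasure_eq_measure)
qed

text \<open>The lower tail contains the unit interval ending at \<open>z\<close>, the upper tail the
  one starting at \<open>z\<close>. Both intervals lie within distance
  \<open>\<bar>z\<bar> + 1\<close> of the origin.\<close>

lemma
  shows std_normal_cdf_ge: "std_normal_density (\<bar>z\<bar> + 1) \<le> std_normal_cdf z"
    and std_normal_cdf_le: "std_normal_cdf z \<le> 1 - std_normal_density (\<bar>z\<bar> + 1)"
proof -
  interpret real_distribution std_normal_distribution
    by (rule real_dist_normal_dist)
  show "std_normal_density (\<bar>z\<bar> + 1) \<le> std_normal_cdf z"
    using std_normal_density_le_cdf_diff[of "z - 1" "\<bar>z\<bar> + 1"] cdf_nonneg[of "z - 1"]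
    by (simp add: std_normal_cdf_def) linarith
  show "std_normal_cdf z \<le> 1 - std_normal_density (\<bar>z\<bar> + 1)"
    using std_normal_density_le_cdf_diff[of z "\<bar>z\<bar> + 1"] cdf_bounded_prob[of "z + 1"]
    by (simp add: std_normal_cdf_def) linarith
qed

lemma std_normal_cdf_pos: "0 < std_normal_cdf z"
  using std_normal_cdf_ge[of z] normal_density_pos[of 1 0 "\<bar>z\<bar> + 1"] by linarith

lemma std_normal_cdf_less_1: "std_normal_cdf z < 1"
  using std_normal_cdf_le[of z] normal_density_pos[of 1 0 "\<bar>z\<bar> + 1"] by linarith

text \<open>A distribution function is continuous wherever there is no atom, and a measure with a
  Lebesgue density has none.\<close>

lemma continuous_on_std_normal_cdf: "continuous_on UNIV std_normal_cdf"
proof -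
  interpret real_distribution std_normal_distribution
    by (rule real_dist_normal_dist)
  have "measure std_normal_distribution {x} = 0" for x
  proof -
    have "AE t in lborel. \<not> t \<in> {x}"
      by (rule AE_not_in) auto
    then have "emeasure std_normal_distribution {x} = 0"
      by (subst emeasure_density) (auto simp: nn_integral_0_iff_AE indicator_def elim: AE_mp)
    then show ?thesis
      by (simp add: measure_def)
  qed
  then show ?thesis
    by (simp add: continuous_on_eq_continuous_at std_normal_cdf_def isCont_cdf)
qed

lemma probit_weight_pos: "0 < probit_weight z"
  unfolding probit_weight_def
  using std_normal_cdf_pos[of z] std_normal_cdf_less_1[of z] normal_density_pos[of 1 0 z] by simp

lemma continuous_on_probit_weight: "continuous_on UNIV probit_weight"
proof -
  have "continuous_on UNIV std_normal_density"
    unfolding std_normal_density_def[abs_def] by (intro continuous_intros) auto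
  moreover have "std_normal_cdf z * (1 - std_normal_cdf z) \<noteq> 0" for z
    using std_normal_cdf_pos[of z] std_normal_cdf_less_1[of z] by simp
  ultimately show ?thesis
    unfolding probit_weight_def[abs_def]
    by (intro continuous_intros continuous_on_std_normal_cdf) auto
qed

text \<open>The numerator is a squared Gaussian, while the denominator is bounded below by a single
  Gaussian shifted by 1. The shift costs a factor of order \<open>exp \<bar>z\<bar>\<close>, so the
  quotient still decays like a Gaussian.\<close>

lemma probit_weight_le: "probit_weight z \<le> exp (5 / 2) * exp (- \<bar>z\<bar>)"
proof -
  let ?F = "std_normal_cdf z" and ?g = "std_normal_density (\<bar>z\<bar> + 1)" and ?c = "1 / sqrt (2 * pi)"
  have g: "0 < ?g"
    by (simp add: normal_density_pos)
  \<comment> \<open>One of the two factors is at least \<open>1/2\<close> and the other at least \<open>?g\<close>.\<close>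
  have "?g / 2 \<le> ?F * (1 - ?F)"
  proof (cases "?F \<le> 1 / 2")
    case True
    then have "?g * (1 / 2) \<le> ?F * (1 - ?F)"
      using std_normal_cdf_ge[of z] g by (intro mult_mono) auto
    then show ?thesis by simp
  next
    case False
    then have "(1 / 2) * ?g \<le> ?F * (1 - ?F)"
      using std_normal_cdf_le[of z] g by (intro mult_mono) auto
    then show ?thesis by simp
  qed
  then have "probit_weight z \<le> (std_normal_density z)\<^sup>2 / (?g / 2)"
    unfolding probit_weight_def using g by (intro divide_left_mono) auto
  also have "\<dots> = 2 * ?c * exp (- z\<^sup>2 / 2 + \<bar>z\<bar> + 1 / 2)"
  proof -
    have "(exp (- z\<^sup>2 / 2))\<^sup>2 = exp (- z\<^sup>2 / 2 + \<bar>z\<bar> + 1 / 2) * exp (- (\<bar>z\<bar> + 1)\<^sup>2 / 2)"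
      by (simp add: power2_eq_square algebra_simps add_divide_distrib diff_divide_distrib flip: exp_add)
    moreover have "0 < ?c"
      by simp
    ultimately show ?thesis
      unfolding std_normal_density_def by (simp only: power_mult_distrib) (simp add: field_simps power2_eq_square)
  qed
  also have "\<dots> \<le> 1 * exp (5 / 2 + - \<bar>z\<bar>)"
  proof (rule mult_mono)
    \<comment> \<open>Here \<open>sqrt 4\<close> stands for 2, so the prefactor
      \<open>2 / sqrt (2 * pi)\<close> is at most 1.\<close>
    have "sqrt 4 \<le> sqrt (2 * pi)"
      using pi_gt3 by (intro real_sqrt_le_mono) simp
    then show "2 * ?c \<le> 1"
      by (simp add: field_simps)
    \<comment> \<open>Completing the square yields the constant 5/2: the two exponents below differ
      by exactly half of this square.\<close>
    have "0 \<le> (\<bar>z\<bar> - 2)\<^sup>2"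
      by simp
    then show "exp (- z\<^sup>2 / 2 + \<bar>z\<bar> + 1 / 2) \<le> exp (5 / 2 + - \<bar>z\<bar>)"
      by (simp add: power2_diff)
  qed auto
  finally show ?thesis
    by (simp flip: exp_add)
qed

lemma cloglog_weight_pos: "0 < cloglog_weight z"
  by (simp add: cloglog_weight_def)

lemma continuous_on_cloglog_weight: "continuous_on UNIV cloglog_weight"
  unfolding cloglog_weight_def[abs_def] by (intro continuous_intros) auto

text \<open>In terms of \<open>t = exp (- z)\<close> the weight is
  \<open>t\<^sup>2 / (exp t - 1)\<close>. For \<open>t \<le> 1\<close> the linear term of the
  exponential bounds it by \<open>t\<close>; for \<open>t > 1\<close> a cubic term bounds it by a
  multiple of \<open>1 / t\<close>. Each is a multiple of \<open>exp (- \<bar>z\<bar>)\<close> in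
  its range.\<close>

lemma cloglog_weight_le: "cloglog_weight z \<le> 27 * exp (- \<bar>z\<bar>)"
proof -
  define t where "t = exp (- z)"
  have t: "0 < t"
    by (simp add: t_def)
  have w: "cloglog_weight z = t\<^sup>2 / (exp t - 1)"
    by (simp add: cloglog_weight_def t_def power2_eq_square flip: exp_add)
  \<comment> \<open>Cubing \<open>1 + t / 3 \<le> exp (t / 3)\<close> gives the linear and the cubic
    lower bound at once; the constant 27 is the cube of 3.\<close>
  have "1 + t + t\<^sup>2 / 3 + t ^ 3 / 27 = (1 + t / 3) ^ 3"
    by (simp add: power3_eq_cube power2_eq_square field_simps)
  also have "\<dots> \<le> exp (t / 3) ^ 3"
    using t by (intro power_mono exp_ge_add_one_self) auto
  also have "\<dots> = exp t"
    by (simp flip: exp_of_nat_mult)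
  finally have "1 + t + t\<^sup>2 / 3 + t ^ 3 / 27 \<le> exp t" .
  then have exp_ge: "t \<le> exp t - 1" "t ^ 3 / 27 \<le> exp t - 1"
    using t zero_le_power[of t 3] zero_le_power[of t 2] by linarith+
  show ?thesis
  proof (cases "0 \<le> z")
    case True
    have "cloglog_weight z \<le> t\<^sup>2 / t"
      unfolding w using t exp_ge by (intro divide_left_mono) auto
    also have "\<dots> \<le> 27 * exp (- \<bar>z\<bar>)"
      using True by (simp add: t_def power2_eq_square)
    finally show ?thesis .
  next
    case False
    have "cloglog_weight z \<le> t\<^sup>2 / (t ^ 3 / 27)"
      unfolding w using t exp_ge by (intro divide_left_mono) auto
    also have "\<dots> = 27 / t"
      using t by (simp add: power2_eq_square power3_eq_cube)
    also have "\<dots> = 27 * exp (- \<bar>z\<bar>)"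
      using False by (simp add: t_def exp_minus divide_inverse)
    finally show ?thesis .
  qed
qed

theorem proposition3:
  fixes X :: "real ^ 'p ^ 'n"
    and m y :: "'n \<Rightarrow> nat"
  assumes "CARD('p) \<le> CARD('n)"
    and "\<And>i. 0 < m i"
    and "\<And>i. y i \<le> m i"
    and "rank X = CARD('p)"
  shows "((\<exists>b. is_maximizer (jeffreys_penalized_loglik probit_prob probit_weight m y X) b) \<and>
          bounded {b. is_maximizer (jeffreys_penalized_loglik probit_prob probit_weight m y X) b}) \<and>
         ((\<exists>b. is_maximizer (jeffreys_penalized_loglik cloglog_prob cloglog_weight m y X) b) \<and>
          bounded {b. is_maximizer (jeffreys_penalized_loglik cloglog_prob cloglog_weight m y X) b})"
proof (intro conjI[of "_ \<and> _" "_ \<and> _"])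
  have probit_prob: "probit_prob = std_normal_cdf"
    by (simp add: probit_prob_def[abs_def])
  show "(\<exists>b. is_maximizer (jeffreys_penalized_loglik probit_prob probit_weight m y X) b) \<and>
      bounded {b. is_maximizer (jeffreys_penalized_loglik probit_prob probit_weight m y X) b}"
    unfolding probit_prob
    by (rule jeffreys_maximizers_exist_bounded[OF assms(2-4) std_normal_cdf_pos std_normal_cdf_less_1
          continuous_on_std_normal_cdf continuous_on_probit_weight probit_weight_pos probit_weight_le])
  have "continuous_on UNIV cloglog_prob"
    unfolding cloglog_prob_def[abs_def] by (intro continuous_intros)
  then show "(\<exists>b. is_maximizer (jeffreys_penalized_loglik cloglog_prob cloglog_weight m y X) b) \<and>
      bounded {b. is_maximizer (jeffreys_penalized_loglik cloglog_prob cloglog_weight m y X) b}"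
    by (intro jeffreys_maximizers_exist_bounded[OF assms(2-4) _ _ _ continuous_on_cloglog_weight
          cloglog_weight_pos cloglog_weight_le]) (simp_all add: cloglog_prob_def)
qed

end
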